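(* Let $r$ be a positive integer and let $G=(V\cup U,E)$ be a finite bipartite graph with parts $V,U$ and minimum degree at least $r$. Then $\overleftarrow{m}(G,r)\ge 2\,m(G,r)$.
   Context: A configuration on a graph is an assignment of states in $\{0,1\}$ (inactive/active) to the vertices; its size $|\omega|$ is the number of active vertices. For an updating rule $f$ the induced process is $\omega^{(0)}=\omega$, $\omega^{(t)}=f(\omega^{(t-1)})$. In $r$-bootstrap percolation ($r$-BP), a vertex becomes active if it has at least $r$ active neighbors and otherwise keeps its state (so active vertices stay active forever). In reversible $r$-BP, a vertex is active in the next round iff it has at least $r$ active neighbors in the current round. A dynamo (for a given rule) is an initial configuration such that from some time on all vertices are active in all subsequent rounds. $m(G,r)$ is the minimum size of a dynamo under $r$-BP on $G$, and $\overleftarrow{m}(G,r)$ is the minimum size of a dynamo under reversible $r$-BP on $G$. *)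

theory Defs
  imports "Graph_Theory.Digraph"
begin

text \<open>
  Undirected finite simple graphs are the locale \<open>graph\<close> of the Graph_Theory library: finite,
  loop-free digraphs without parallel arcs whose adjacency relation is symmetric. An edge is a pair
  of opposite arcs, so the degree of a vertex is its \<open>out_degree\<close>.
  A configuration is represented by its set of active vertices, a subset of \<open>verts G\<close>; its size
  is the cardinality of that set.
\<close>

definition bipartition :: "('a, 'b) pre_digraph \<Rightarrow> 'a set \<Rightarrow> 'a set \<Rightarrow> bool" where
  "bipartition G V U \<longleftrightarrow> verts G = V \<union> U \<and> V \<inter> U = {} \<and>
     (\<forall>x y. x \<rightarrow>\<^bsub>G\<^esub> y \<longrightarrow> x \<in> V \<and> y \<in> U \<or> x \<in> U \<and> y \<in> V)"

definition active_nbrs :: "('a, 'b) pre_digraph \<Rightarrow> 'a set \<Rightarrow> 'a \<Rightarrow> 'a set" where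
  "active_nbrs G \<omega> x = {y \<in> \<omega>. x \<rightarrow>\<^bsub>G\<^esub> y}"

definition bp :: "('a, 'b) pre_digraph \<Rightarrow> nat \<Rightarrow> 'a set \<Rightarrow> 'a set" where
  "bp G r \<omega> = {x \<in> verts G. x \<in> \<omega> \<or> r \<le> card (active_nbrs G \<omega> x)}"

definition reversible_bp :: "('a, 'b) pre_digraph \<Rightarrow> nat \<Rightarrow> 'a set \<Rightarrow> 'a set" where
  "reversible_bp G r \<omega> = {x \<in> verts G. r \<le> card (active_nbrs G \<omega> x)}"

definition dynamo :: "('a, 'b) pre_digraph \<Rightarrow> ('a set \<Rightarrow> 'a set) \<Rightarrow> 'a set \<Rightarrow> bool" where
  "dynamo G f \<omega> \<longleftrightarrow> \<omega> \<subseteq> verts G \<and> (\<exists>T. \<forall>t\<ge>T. (f ^^ t) \<omega> = verts G)"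

definition min_dynamo_size :: "('a, 'b) pre_digraph \<Rightarrow> ('a set \<Rightarrow> 'a set) \<Rightarrow> nat" where
  "min_dynamo_size G f = (LEAST k. \<exists>\<omega>. dynamo G f \<omega> \<and> card \<omega> = k)"

definition m_bp :: "('a, 'b) pre_digraph \<Rightarrow> nat \<Rightarrow> nat" where
  "m_bp G r = min_dynamo_size G (bp G r)"

definition m_reversible_bp :: "('a, 'b) pre_digraph \<Rightarrow> nat \<Rightarrow> nat" where
  "m_reversible_bp G r = min_dynamo_size G (reversible_bp G r)"

text \<open>
  The minima are attained: the all-active configuration is a dynamo, for the reversible rule
  because every degree is at least \<open>r\<close>.
\<close>

lemma dynamo_verts_if_fixed: "f (verts G) = verts G \<Longrightarrow> dynamo G f (verts G)"
proof -
  assume "f (verts G) = verts G"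
  then have "(f ^^ t) (verts G) = verts G" for t
    by (induction t) simp_all
  then show ?thesis
    by (simp add: dynamo_def)
qed

lemma dynamo_bp_verts: "dynamo G (bp G r) (verts G)"
  by (rule dynamo_verts_if_fixed) (auto simp: bp_def)

lemma (in graph) card_active_nbrs_verts: "card (active_nbrs G (verts G) x) = out_degree G x"
proof -
  have "active_nbrs G (verts G) x = head G ` out_arcs G x"
    by (auto simp: active_nbrs_def arcs_ends_def arc_to_ends_def)
  moreover have "inj_on (head G) (out_arcs G x)"
    by (rule inj_onI) (auto intro: no_multi_arcs simp: arc_to_ends_def)
  ultimately show ?thesis
    by (simp add: out_degree_def card_image)
qed

lemma (in graph) dynamo_reversible_bp_verts:
  "(\<forall>x\<in>verts G. r \<le> out_degree G x) \<Longrightarrow> dynamo G (reversible_bp G r) (verts G)"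
  by (rule dynamo_verts_if_fixed) (auto simp: reversible_bp_def card_active_nbrs_verts)

end

theory Submission
  imports Defs
begin

text \<open>
  On a bipartite graph the states of \<open>V\<close> at time \<open>t\<close> determine the states of \<open>U\<close> at time \<open>t + 1\<close>
  under the reversible rule, and vice versa. Hence a reversible dynamo \<open>\<omega>\<close> runs two independent
  processes, one started from \<open>\<omega> \<inter> V\<close> and one from \<open>\<omega> \<inter> U\<close>, each of which eventually
  fills the two parts alternately. Bootstrap percolation from \<open>\<omega> \<inter> V\<close> dominates the first process
  and never loses active vertices, so it fills the whole graph; likewise for \<open>\<omega> \<inter> U\<close>.
  Thus \<open>\<omega>\<close> splits into two dynamos for bootstrap percolation.
\<close>

lemma bipartition_sym: "bipartition G V U \<Longrightarrow> bipartition G U V"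
  unfolding bipartition_def by blast

lemma funpow_bp_subset_verts: "\<omega> \<subseteq> verts G \<Longrightarrow> (bp G r ^^ t) \<omega> \<subseteq> verts G"
  by (induction t) (auto simp: bp_def)

lemma subset_bp: "\<omega> \<subseteq> verts G \<Longrightarrow> \<omega> \<subseteq> bp G r \<omega>"
  by (auto simp: bp_def)

lemma min_dynamo_size_le: "dynamo G f \<omega> \<Longrightarrow> min_dynamo_size G f \<le> card \<omega>"
  unfolding min_dynamo_size_def by (rule Least_le) blast

text \<open>The given dynamo only witnesses that some size occurs; without one, \<open>LEAST\<close>
  would be unspecified.\<close>

lemma min_dynamo_size_attained:
  assumes "dynamo G f \<omega>"
  obtains \<omega>' where "dynamo G f \<omega>'" "card \<omega>' = min_dynamo_size G f"
proof -
  have "\<exists>\<omega>'. dynamo G f \<omega>' \<and> card \<omega>' = min_dynamo_size G f"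
    unfolding min_dynamo_size_def by (rule LeastI_ex) (use assms in blast)
  then show ?thesis
    using that by blast
qed

text \<open>The parity of \<open>t\<close> selects the part whose reversible states depend only on
  \<open>\<omega> \<inter> V\<close>. Exchanging \<open>V\<close> and \<open>U\<close> gives the
  statement for the other process.\<close>

lemma funpow_reversible_bp_subset_funpow_bp:
  assumes fin: "finite (verts G)" and bip: "bipartition G V U" and "\<omega> \<subseteq> verts G"
  shows "(reversible_bp G r ^^ t) \<omega> \<inter> (if even t then V else U) \<subseteq> (bp G r ^^ t) (\<omega> \<inter> V)"
proof (induction t)
  case 0
  show ?case by simp
next
  case (Suc t)
  let ?R = "(reversible_bp G r ^^ t) \<omega>" and ?B = "(bp G r ^^ t) (\<omega> \<inter> V)"
  \<comment> \<open>An infinite set has \<open>card\<close> 0, so \<open>card_mono\<close> below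
    needs this.\<close>
  have "finite ?B"
    by (rule finite_subset[OF funpow_bp_subset_verts fin]) (use \<open>\<omega> \<subseteq> verts G\<close> in blast)
  show ?case
  proof
    fix x
    assume x: "x \<in> (reversible_bp G r ^^ Suc t) \<omega> \<inter> (if even (Suc t) then V else U)"
    have "active_nbrs G ?R x \<subseteq> active_nbrs G ?B x"
    proof
      fix y
      assume "y \<in> active_nbrs G ?R x"
      then have y: "y \<in> ?R" "x \<rightarrow>\<^bsub>G\<^esub> y"
        by (simp_all add: active_nbrs_def)
      \<comment> \<open>Edges switch parts, so \<open>y\<close> lies in the part that the induction
        hypothesis controls at time \<open>t\<close>.\<close>
      then have "y \<in> (if even t then V else U)"
        using bip x unfolding bipartition_def by (cases "even t") (simp, blast)+
      then show "y \<in> active_nbrs G ?B x"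
        using Suc.IH y unfolding active_nbrs_def by blast
    qed
    then have "card (active_nbrs G ?R x) \<le> card (active_nbrs G ?B x)"
      using \<open>finite ?B\<close> by (intro card_mono) (auto simp: active_nbrs_def)
    then show "x \<in> (bp G r ^^ Suc t) (\<omega> \<inter> V)"
      using x by (auto simp: reversible_bp_def bp_def)
  qed
qed

lemma dynamo_bp_part:
  assumes fin: "finite (verts G)" and bip: "bipartition G V U"
    and dyn: "dynamo G (reversible_bp G r) \<omega>"
  shows "dynamo G (bp G r) (\<omega> \<inter> V)"
proof -
  let ?B = "\<lambda>t. (bp G r ^^ t) (\<omega> \<inter> V)"
  from dyn obtain T where sub: "\<omega> \<subseteq> verts G"
    and T: "\<And>t. T \<le> t \<Longrightarrow> (reversible_bp G r ^^ t) \<omega> = verts G"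
    by (auto simp: dynamo_def)
  have B_sub: "?B t \<subseteq> verts G" for t
    by (rule funpow_bp_subset_verts) (use sub in blast)
  have verts: "verts G = V \<union> U"
    using bip by (simp add: bipartition_def)
  have part: "(if even t then V else U) \<subseteq> ?B t" if "T \<le> t" for t
    using funpow_reversible_bp_subset_funpow_bp[OF fin bip sub, of t r] T[OF that] verts
    by (auto split: if_splits)
  \<comment> \<open>Domination yields one part per round. The extra round supplies the other part,
    while the part filled at time \<open>t - 1\<close> stays active.\<close>
  have "?B t = verts G" if "Suc T \<le> t" for t
  proof -
    from that obtain s where s: "t = Suc s" "T \<le> s"
      by (cases t) auto
    have "?B s \<subseteq> ?B t"
      using subset_bp[OF B_sub[of s], of r] s by simp
    then have "V \<union> U \<subseteq> ?B t"
      using part[of s] part[of t] s by (auto split: if_splits)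
    then show ?thesis
      using B_sub[of t] verts by blast
  qed
  then show ?thesis
    using sub unfolding dynamo_def by blast
qed

theorem theorem1:
  fixes G :: "('a, 'b) pre_digraph" and V U :: "'a set" and r :: nat
  assumes "r > 0"
    and "graph G"
    and "bipartition G V U"
    and "\<forall>x\<in>verts G. r \<le> out_degree G x"
  shows "m_reversible_bp G r \<ge> 2 * m_bp G r"
proof -
  interpret graph G by fact
  obtain \<omega> where dyn: "dynamo G (reversible_bp G r) \<omega>"
    and card: "card \<omega> = m_reversible_bp G r"
    using min_dynamo_size_attained[OF dynamo_reversible_bp_verts[OF assms(4)]]
    unfolding m_reversible_bp_def by blast
  have "m_bp G r \<le> card (\<omega> \<inter> V)"
    unfolding m_bp_def
    by (rule min_dynamo_size_le[OF dynamo_bp_part[OF finite_verts assms(3) dyn]])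
  \<comment> \<open>The same bound with the two parts exchanged.\<close>
  moreover have "m_bp G r \<le> card (\<omega> \<inter> U)"
    unfolding m_bp_def
    by (rule min_dynamo_size_le[OF dynamo_bp_part[OF finite_verts bipartition_sym[OF assms(3)] dyn]])
  moreover have "card \<omega> = card (\<omega> \<inter> V) + card (\<omega> \<inter> U)"
  proof -
    have "\<omega> \<subseteq> verts G"
      using dyn by (simp add: dynamo_def)
    with finite_verts have "finite \<omega>"
      by (rule rev_finite_subset)
    moreover have "\<omega> = (\<omega> \<inter> V) \<union> (\<omega> \<inter> U)" "(\<omega> \<inter> V) \<inter> (\<omega> \<inter> U) = {}"
      using \<open>\<omega> \<subseteq> verts G\<close> assms(3) by (auto simp: bipartition_def)
    ultimately show ?thesis
      using card_Un_disjoint[of "\<omega> \<inter> V" "\<omega> \<inter> U"] by simp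
  qed
  ultimately show ?thesis
    using card by linarith
qed

end
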